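(* Consider the control-affine system with disturbance $$\dot x = f(x)+g(x)u+p(x)d,\qquad x\in\mathbb{R}^{N},\ u\in\mathbb{R}^{m_1},\ d\in\mathbb{R}^{m_2},$$ where the disturbance $d=d(t)$ is unknown and satisfies $\|d(t)\|\le M$ for all $t$, with a known scalar $M>0$. Let $h_1:\mathbb{R}^{N}\to\mathbb{R}$ be a candidate control barrier function of relative degree $n>1$ (in the sense given in the context), with safe set $\mathcal{C}=\{x\in\mathbb{R}^{N}: h_1(x)\ge 0\}$. Assume that $h_1$ is $n$-times differentiable, that $\frac{\partial h_1}{\partial x}(x)\neq 0$ for all $x\in\mathcal{C}$, and that the initial state $x(t_0)=x_0$ lies in the safe set but not on its boundary, i.e. $h_1(x_0)>0$. Let $\varepsilon_1,\dots,\varepsilon_n>0$, and for $k=1,\dots,n$ write $\delta_k(x)=\sqrt{\varepsilon_k+\|L_p h_k(x)\|^2}$. Define recursively, for $i=2,\dots,n$, $$h_i(x)=c_{i-1}h_{i-1}(x)+L_f h_{i-1}(x)-M\delta_{i-1}(x),$$ where the gains are chosen successively so that $$c_{i-1}>\max\left\{0,\ \frac{-L_f h_{i-1}(x_0)+M\delta_{i-1}(x_0)}{h_{i-1}(x_0)}\right\},\qquad i=2,\dots,n,$$ and let $c_n>0$. For a nominal control $u_0=u_0(t)\in\mathbb{R}^{m_1}$, set $$\eta(x,u_0)=L_f h_n(x)+L_g h_n(x)u_0-M\delta_n(x)+c_n h_n(x),$$ and apply the control law $$u=\begin{cases}u_0, & \eta(x,u_0)\ge 0,\\[2mm] u_0-(L_g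 h_n(x))^\top\dfrac{\eta(x,u_0)}{\|L_g h_n(x)\|^2}, & \text{otherwise.}\end{cases}$$ Then, for every nominal control $u_0$ and every disturbance $d$ with $\|d(t)\|\le M$, every solution $x(t)$, $t\in[t_0,\infty)$, of the resulting closed-loop system with $x(t_0)=x_0$ satisfies $h_1(x(t))\ge 0$ for all $t\in[t_0,\infty)$.
   Context: Notation. $\|\cdot\|$ is the Euclidean norm. For a differentiable $h:\mathbb{R}^{N}\to\mathbb{R}$, the Lie derivatives are $L_f h(x)=\frac{\partial h}{\partial x}(x)f(x)\in\mathbb{R}$, $L_g h(x)=\frac{\partial h}{\partial x}(x)g(x)$ (a row vector in $\mathbb{R}^{1\times m_1}$), and $L_p h(x)=\frac{\partial h}{\partial x}(x)p(x)$ (a row vector in $\mathbb{R}^{1\times m_2}$), where $f:\mathbb{R}^N\to\mathbb{R}^N$, $g:\mathbb{R}^N\to\mathbb{R}^{N\times m_1}$, $p:\mathbb{R}^N\to\mathbb{R}^{N\times m_2}$. The functions $f,g,p$ are assumed regular enough that $h_1,\dots,h_n$ are continuously differentiable, so that all expressions above make sense. Candidate. A candidate (control) barrier function is a scalar-valued differentiable function $h$ on $\mathbb{R}^N$ with $\inf_x h(x)<0$ and $\sup_x h(x)>0$. Relative degree. That $h_1$ has relative degree $n$ means, for the chain $h_1,\dots,h_n$ constructed in the claim, that the control does not enter the time derivative of $h_1,\dots,h_{n-1}$, i.e. $L_g h_j(x)=0$ for all $x$ and $j=1,\dots,n-1$, while the target function $h_n$ has relative degree one, i.e. $L_g h_n(x)\neq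 0$ for all $x\in\mathcal{C}$ (so that the control law is well defined on $\mathcal C$). The control law is the explicit solution of the quadratic program: minimize $\|u-u_0\|^2$ over $u$ subject to $L_f h_n(x)+L_g h_n(x)u-M\delta_n(x)\ge -c_n h_n(x)$. *)

theory Defs
  imports "HOL-Analysis.Analysis"
begin

text \<open>
  Only meaningful where \<open>h\<close> is differentiable, since \<^const>\<open>frechet_derivative\<close> is
  a choice function.
\<close>
definition row_deriv :: "(real ^ 'N \<Rightarrow> real) \<Rightarrow> real ^ 'N \<Rightarrow> real ^ 'N"
  where "row_deriv h x = (\<chi> i. frechet_derivative h (at x) (axis i 1))"

definition lie_deriv :: "(real ^ 'N \<Rightarrow> real ^ 'N) \<Rightarrow> (real ^ 'N \<Rightarrow> real) \<Rightarrow> real ^ 'N \<Rightarrow> real"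
  where "lie_deriv f h x = row_deriv h x \<bullet> f x"

definition lie_deriv_row ::
    "(real ^ 'N \<Rightarrow> real ^ 'm ^ 'N) \<Rightarrow> (real ^ 'N \<Rightarrow> real) \<Rightarrow> real ^ 'N \<Rightarrow> real ^ 'm"
  where "lie_deriv_row g h x = row_deriv h x v* g x"

definition continuously_differentiable :: "(real ^ 'N \<Rightarrow> real) \<Rightarrow> bool"
  where "continuously_differentiable h \<longleftrightarrow>
    (\<forall>x. h differentiable (at x)) \<and> continuous_on UNIV (row_deriv h)"

text \<open>
  The Frechet derivative is differentiable at a point iff all its directional components
  \<open>\<lambda>x. Dh(x) v\<close> are, because the domain is finite-dimensional.
\<close>
primrec times_differentiable :: "nat \<Rightarrow> ('a::euclidean_space \<Rightarrow> real) \<Rightarrow> bool" where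
  "times_differentiable 0 h \<longleftrightarrow> True"
| "times_differentiable (Suc k) h \<longleftrightarrow>
    (\<forall>x. h differentiable (at x)) \<and>
    (\<forall>v. times_differentiable k (\<lambda>x. frechet_derivative h (at x) v))"

text \<open>
  Infimum and supremum are taken in the extended reals, since \<open>h\<close> may be unbounded.
\<close>
definition candidate_barrier :: "(real ^ 'N \<Rightarrow> real) \<Rightarrow> bool"
  where "candidate_barrier h \<longleftrightarrow>
    (\<forall>x. h differentiable (at x)) \<and> (INF x. ereal (h x)) < 0 \<and> (SUP x. ereal (h x)) > 0"

definition safe_set :: "(real ^ 'N \<Rightarrow> real) \<Rightarrow> (real ^ 'N) set"
  where "safe_set h = {x. h x \<ge> 0}"

text \<open>
  Relative degree \<open>n\<close> of \<open>h 1\<close> with respect to the chain \<open>h 1, \<dots>, h n\<close>.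
\<close>
definition has_relative_degree ::
    "(real ^ 'N \<Rightarrow> real ^ 'm ^ 'N) \<Rightarrow> (nat \<Rightarrow> real ^ 'N \<Rightarrow> real) \<Rightarrow> nat \<Rightarrow> bool"
  where "has_relative_degree g h n \<longleftrightarrow>
    (\<forall>j\<in>{1..n-1}. \<forall>x. lie_deriv_row g (h j) x = 0) \<and>
    (\<forall>x\<in>safe_set (h 1). lie_deriv_row g (h n) x \<noteq> 0)"

definition barrier_delta ::
    "(real ^ 'N \<Rightarrow> real ^ 'm ^ 'N) \<Rightarrow> real \<Rightarrow> (real ^ 'N \<Rightarrow> real) \<Rightarrow> real ^ 'N \<Rightarrow> real"
  where "barrier_delta p e h x = sqrt (e + (norm (lie_deriv_row p h x))\<^sup>2)"

text \<open>
  In the next two definitions \<open>h\<close>, \<open>e\<close>, \<open>c\<close> are the last function, smoothing parameter and gain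
  of the chain.
\<close>
definition barrier_eta ::
    "(real ^ 'N \<Rightarrow> real ^ 'N) \<Rightarrow> (real ^ 'N \<Rightarrow> real ^ 'm1 ^ 'N) \<Rightarrow> (real ^ 'N \<Rightarrow> real ^ 'm2 ^ 'N) \<Rightarrow>
     real \<Rightarrow> real \<Rightarrow> real \<Rightarrow> (real ^ 'N \<Rightarrow> real) \<Rightarrow> real ^ 'N \<Rightarrow> real ^ 'm1 \<Rightarrow> real"
  where "barrier_eta f g p M e c h x v =
    lie_deriv f h x + lie_deriv_row g h x \<bullet> v - M * barrier_delta p e h x + c * h x"

text \<open>
  At a point with \<open>lie_deriv_row g h x = 0\<close>, where the law is undefined on paper, this
  evaluates to the nominal control \<open>v\<close>.
\<close>
definition barrier_control ::
    "(real ^ 'N \<Rightarrow> real ^ 'N) \<Rightarrow> (real ^ 'N \<Rightarrow> real ^ 'm1 ^ 'N) \<Rightarrow> (real ^ 'N \<Rightarrow> real ^ 'm2 ^ 'N) \<Rightarrow>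
     real \<Rightarrow> real \<Rightarrow> real \<Rightarrow> (real ^ 'N \<Rightarrow> real) \<Rightarrow> real ^ 'N \<Rightarrow> real ^ 'm1 \<Rightarrow> real ^ 'm1"
  where "barrier_control f g p M e c h x v =
    (if barrier_eta f g p M e c h x v \<ge> 0 then v
     else v - (barrier_eta f g p M e c h x v / (norm (lie_deriv_row g h x))\<^sup>2) *\<^sub>R lie_deriv_row g h x)"

text \<open>
  Solutions of \<open>x' = F t x\<close> on \<open>[t0, \<infinity>)\<close>. The nominal control and the disturbance carry no
  regularity assumption in time, so a solution need not be differentiable everywhere. The
  equation is therefore read in integrated form, with the Henstock-Kurzweil integral. By the two
  lemmas below, both classical and Caratheodory solutions are solutions in this sense.
\<close>
definition ode_solution ::
    "(real \<Rightarrow> 'a \<Rightarrow> 'a) \<Rightarrow> real \<Rightarrow> (real \<Rightarrow> 'a::euclidean_space) \<Rightarrow> bool"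
  where "ode_solution F t0 x \<longleftrightarrow>
    (\<forall>t\<ge>t0. ((\<lambda>s. F s (x s)) has_integral (x t - x t0)) {t0..t})"

lemma ode_solution_classical:
  assumes "\<And>t. t \<ge> t0 \<Longrightarrow> (x has_vector_derivative F t (x t)) (at t within {t0..})"
  shows "ode_solution F t0 x"
  unfolding ode_solution_def
proof (intro allI impI)
  fix t assume "t0 \<le> t"
  then show "((\<lambda>s. F s (x s)) has_integral (x t - x t0)) {t0..t}"
    by (intro fundamental_theorem_of_calculus)
       (auto intro: has_vector_derivative_within_subset[OF assms])
qed

lemma ode_solution_Caratheodory:
  assumes "\<And>t. t \<ge> t0 \<Longrightarrow> set_integrable lebesgue {t0..t} (\<lambda>s. F s (x s))"
    and "\<And>t. t \<ge> t0 \<Longrightarrow> x t = x t0 + (LINT s:{t0..t}|lebesgue. F s (x s))"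
  shows "ode_solution F t0 x"
  unfolding ode_solution_def
proof (intro allI impI)
  fix t assume t: "t0 \<le> t"
  show "((\<lambda>s. F s (x s)) has_integral (x t - x t0)) {t0..t}"
    using has_integral_set_lebesgue[OF assms(1)[OF t]] assms(2)[OF t] by simp
qed

end

theory Submission
  imports Defs
begin

text \<open>
  Up to the first time \<open>T\<close> at which \<open>h 1\<close> vanishes along the solution, the state is in the safe
  set. There the row \<open>L\<^sub>g h\<^sub>n\<close> does not vanish, so the quadratic-program control enforces its
  constraint, and, since the margin \<open>M \<delta>\<^sub>k \<ge> M \<parallel>L\<^sub>p h\<^sub>k\<parallel>\<close> dominates every admissible disturbance,
  \<open>w\<^sub>n(t) = h\<^sub>n (x t)\<close> satisfies \<open>w\<^sub>n' \<ge> - c\<^sub>n w\<^sub>n\<close>. A function that starts positive and obeys such an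
  inequality stays positive. For \<open>k < n\<close> the control does not enter, and the definition of the chain
  reads \<open>w\<^sub>k' \<ge> w\<^sub>k\<^sub>+\<^sub>1 - c\<^sub>k w\<^sub>k\<close>; so positivity of \<open>w\<^sub>k\<^sub>+\<^sub>1\<close> gives \<open>w\<^sub>k' \<ge> - c\<^sub>k w\<^sub>k\<close> and thereby positivity
  of \<open>w\<^sub>k\<close>. All the \<open>w\<^sub>k\<close> start positive, as the lower bounds on the gains ensure inductively.
  Descending from \<open>n\<close> to \<open>1\<close> yields \<open>h 1 (x T) > 0\<close>, against the choice of \<open>T\<close>.

  The analytic difficulty is the meaning of \<open>w'\<close>. A solution satisfies the differential equation only
  in the sense of Henstock-Kurzweil integrals, so it need not be absolutely continuous, and
  information on derivatives almost everywhere does not by itself control \<open>w\<close>. The differential inequalities are therefore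
  read in integrated form. What makes this possible is a chain rule for indefinite
  Henstock-Kurzweil integrals, \<open>has_integral_chain_rule\<close>: if \<open>v\<close> integrates to \<open>x\<close>, then
  \<open>Dh(x) v\<close> integrates to \<open>h \<circ> x\<close>. The comparison step is \<open>positive_if_rate_ge\<close>.
\<close>

hide_const (open) Polynomial.content

section \<open>A chain rule for indefinite Henstock-Kurzweil integrals\<close>

text \<open>
  Shrinking each cell of a partial division around its tag gives a partial division again, still fine
  for the same gauge, so Henstock's lemma bounds the errors on the shrunken cells too. This is used
  to cut every cell at its tag into a left and a right half.
\<close>
lemma Henstock_bound_subcells:
  fixes v :: "'m::euclidean_space \<Rightarrow> 'n::euclidean_space"
  assumes henstock: "\<And>q. \<lbrakk>q tagged_partial_division_of cbox a b; \<gamma> fine q\<rbrakk> \<Longrightarrow>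
      (\<Sum>(t,K)\<in>q. norm (content K *\<^sub>R v t - integral K v)) < e"
    and q: "q tagged_partial_division_of cbox a b" "\<gamma> fine q"
    and J: "\<And>t K. (t,K) \<in> q \<Longrightarrow> (\<exists>u w. J t K = cbox u w) \<and> t \<in> J t K \<and> J t K \<subseteq> K"
  shows "(\<Sum>(t,K)\<in>q. norm (content (J t K) *\<^sub>R v t - integral (J t K) v)) < e"
proof -
  let ?r = "\<lambda>(t,K). (t, J t K)"
  let ?err = "\<lambda>(t,K). norm (content K *\<^sub>R v t - integral K v)"
  note qD = tagged_partial_division_ofD[OF q(1)]
  have int_sub: "interior (J t K) \<subseteq> interior K" if "(t,K) \<in> q" for t K
    using J[OF that] by (simp add: interior_mono)
  have "(\<Sum>(t,K)\<in>q. norm (content (J t K) *\<^sub>R v t - integral (J t K) v)) = sum (?err \<circ> ?r) q"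
    by (rule sum.cong) auto
  also have "\<dots> = sum ?err (?r ` q)"
    \<comment> \<open>Distinct cells may shrink to the same cell, but then it lies in two cells with disjoint
      interiors, hence is degenerate and contributes no error.\<close>
  proof (rule sum.reindex_nontrivial[symmetric, OF qD(1)])
    fix z z' assume z: "z \<in> q" "z' \<in> q" "z \<noteq> z'" "?r z = ?r z'"
    obtain t K where zK: "z = (t,K)" by (cases z)
    with z obtain K' where zK': "z' = (t,K')" by (cases z') auto
    have tK: "(t,K) \<in> q" "(t,K') \<in> q" "K \<noteq> K'" "J t K = J t K'"
      using z zK zK' by auto
    have "interior (J t K) \<subseteq> interior K \<inter> interior K'"
      using int_sub[OF tK(1)] int_sub[OF tK(2)] tK(4) by simp
    also have "\<dots> = {}"
      using qD(5)[OF tK(1,2)] tK(3) by simp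
    finally have "interior (J t K) = {}" by simp
    moreover obtain u w where "J t K = cbox u w"
      using J[OF tK(1)] by auto
    ultimately have "content (J t K) = 0" "integral (J t K) v = 0"
      using content_eq_0_interior[of u w] by auto
    then show "?err (?r z) = 0" by (simp add: zK)
  qed
  also have "\<dots> < e"
  proof (rule henstock)
    show "?r ` q tagged_partial_division_of cbox a b"
      unfolding tagged_partial_division_of_def
    proof (intro conjI allI impI)
      show "finite (?r ` q)" using qD(1) by simp
      fix t K' assume "(t,K') \<in> ?r ` q"
      then obtain K where K: "(t,K) \<in> q" "K' = J t K" by auto
      show "t \<in> K'" "\<exists>u w. K' = cbox u w" using J[OF K(1)] K(2) by auto
      show "K' \<subseteq> cbox a b" using J[OF K(1)] K(2) qD(3)[OF K(1)] by auto
    next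
      fix t1 K1' t2 K2'
      assume "(t1, K1') \<in> ?r ` q \<and> (t2, K2') \<in> ?r ` q \<and> (t1, K1') \<noteq> (t2, K2')"
      then obtain K1 K2 where K: "(t1,K1) \<in> q" "K1' = J t1 K1" "(t2,K2) \<in> q" "K2' = J t2 K2"
        "(t1,K1) \<noteq> (t2,K2)" by auto
      show "interior K1' \<inter> interior K2' = {}"
        using int_sub[OF K(1)] int_sub[OF K(3)] qD(5)[OF K(1,3,5)] K(2,4) by blast
    qed
    show "\<gamma> fine ?r ` q"
      using q(2) J unfolding fine_def by fastforce
  qed
  finally show ?thesis .
qed

lemma indefinite_integral_increment:
  fixes x v :: "real \<Rightarrow> 'a::euclidean_space"
  assumes "\<And>t. t \<in> {a..b} \<Longrightarrow> (v has_integral (x t - x a)) {a..t}"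
    and "a \<le> s" "s \<le> t" "t \<le> b"
  shows "(v has_integral (x t - x s)) {s..t}"
proof -
  have at: "(v has_integral (x t - x a)) {a..t}" and as: "(v has_integral (x s - x a)) {a..s}"
    using assms by auto
  have "v integrable_on {s..t}"
    using has_integral_integrable[OF at] by (rule integrable_subinterval_real) (use assms(2) in auto)
  moreover have "integral {s..t} v = x t - x s"
    using Henstock_Kurzweil_Integration.integral_combine[OF assms(2,3) has_integral_integrable[OF at]]
      integral_unique[OF at] integral_unique[OF as] by (simp add: algebra_simps)
  ultimately show ?thesis by (metis has_integral_integrable_integral)
qed

lemma indefinite_integral_continuous:
  fixes x v :: "real \<Rightarrow> 'a::euclidean_space"
  assumes "a \<le> b" and "\<And>t. t \<in> {a..b} \<Longrightarrow> (v has_integral (x t - x a)) {a..t}"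
  shows "continuous_on {a..b} x"
proof -
  have "continuous_on {a..b} (\<lambda>t. integral {a..t} v + x a)"
    using assms by (intro continuous_intros indefinite_integral_continuous_1) auto
  then show ?thesis
    by (rule continuous_on_eq) (simp add: integral_unique[OF assms(2)])
qed

text \<open>
  The remainder of the first-order expansion of \<open>h\<close> at \<open>x t\<close> is \<open>o(\<parallel>x s - x t\<parallel>)\<close>. As \<open>x\<close> need not be
  differentiable at \<open>t\<close>, the increment \<open>x s - x t\<close> is split into \<open>(s - t) v(t)\<close> and an error that is
  kept in the estimate, because only the sum of these errors over a division is small.
\<close>
lemma first_order_expansion_near:
  fixes x v :: "real \<Rightarrow> 'a::euclidean_space" and h :: "'a \<Rightarrow> 'b::real_normed_vector"
  assumes cont: "continuous_on S x" and t: "t \<in> S"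
    and deriv: "(h has_derivative h') (at (x t))"
    and bound: "\<And>u. norm (h' u) \<le> L * norm u"
    and e: "e > 0"
  obtains r where "r > 0" "\<And>s. \<lbrakk>s \<in> S; \<bar>s - t\<bar> < r\<rbrakk> \<Longrightarrow>
    norm (h (x s) - h (x t) - (s - t) *\<^sub>R h' (v t))
      \<le> e * \<bar>s - t\<bar> + (L + e) * norm (x s - x t - (s - t) *\<^sub>R v t)"
proof -
  \<comment> \<open>A tolerance depending on \<open>t\<close>: since \<open>v\<close> may be unbounded, no uniform one would turn the
    contribution \<open>k * norm (v t) * \<bar>s - t\<bar>\<close> into at most \<open>e * \<bar>s - t\<bar>\<close>.\<close>
  define k where "k = e / (norm (v t) + 1)"
  have nv: "norm (v t) + 1 > 0" by (smt (verit) norm_ge_zero)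
  have k: "k > 0" "k \<le> e" "k * norm (v t) \<le> e"
    using e nv by (auto simp: k_def field_simps)
  obtain r1 where r1: "r1 > 0" "\<And>y. norm (y - x t) < r1 \<Longrightarrow>
      norm (h y - h (x t) - h' (y - x t)) \<le> k * norm (y - x t)"
    using deriv k(1) unfolding has_derivative_at_alt by blast
  obtain r where r: "r > 0" "\<And>s. \<lbrakk>s \<in> S; dist s t < r\<rbrakk> \<Longrightarrow> dist (x s) (x t) < r1"
    using cont t r1(1) unfolding continuous_on_iff by blast
  have lin: "bounded_linear h'" using deriv by (rule has_derivative_bounded_linear)
  show thesis
  proof (rule that[OF r(1)])
    fix s assume s: "s \<in> S" "\<bar>s - t\<bar> < r"
    define E where "E = x s - x t - (s - t) *\<^sub>R v t"
    have xs: "x s - x t = E + (s - t) *\<^sub>R v t" by (simp add: E_def)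
    have 1: "norm (h (x s) - h (x t) - h' (x s - x t)) \<le> k * norm (x s - x t)"
      using r1(2) r(2)[OF s(1)] s(2) by (simp add: dist_norm)
    have "k * norm (x s - x t) \<le> k * (norm E + \<bar>s - t\<bar> * norm (v t))"
      unfolding xs using k(1) by (intro mult_left_mono order.trans[OF norm_triangle_ineq]) auto
    also have "\<dots> = k * norm E + \<bar>s - t\<bar> * (k * norm (v t))" by (simp add: algebra_simps)
    also have "\<dots> \<le> e * norm E + \<bar>s - t\<bar> * e"
      using k by (intro add_mono mult_right_mono mult_left_mono) auto
    finally have 2: "k * norm (x s - x t) \<le> e * norm E + \<bar>s - t\<bar> * e" .
    have "h' (x s - x t) = h' E + (s - t) *\<^sub>R h' (v t)"
      unfolding xs by (simp add: lin bounded_linear.linear linear_add linear_scale)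
    then have "h (x s) - h (x t) - (s - t) *\<^sub>R h' (v t) =
        (h (x s) - h (x t) - h' (x s - x t)) + h' E" by simp
    then have "norm (h (x s) - h (x t) - (s - t) *\<^sub>R h' (v t)) \<le> k * norm (x s - x t) + L * norm E"
      using 1 bound[of E] norm_triangle_ineq by (smt (verit))
    then show "norm (h (x s) - h (x t) - (s - t) *\<^sub>R h' (v t))
        \<le> e * \<bar>s - t\<bar> + (L + e) * norm (x s - x t - (s - t) *\<^sub>R v t)"
      using 2 unfolding E_def[symmetric] by (simp add: algebra_simps del: scaleR_diff_left)
  qed
qed

text \<open>
  On a fine division the Riemann sum of \<open>h' t (v t)\<close> differs from the telescoping sum of the increments
  of \<open>h \<circ> x\<close>, cell by cell, by at most a small multiple of the length of the cell plus a multiple of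
  the error that \<open>v\<close> makes as a Riemann approximation to \<open>x\<close> on the two halves of the cell. Henstock's
  lemma makes the latter errors summable to something small. A gauge can depend on the tag
  arbitrarily, and so pointwise differentiability of \<open>h\<close> along \<open>x\<close> suffices, given a
  uniform bound on the derivative.
\<close>
lemma has_integral_chain_rule:
  fixes x v :: "real \<Rightarrow> 'a::euclidean_space" and h :: "'a \<Rightarrow> 'b::real_normed_vector"
  assumes ab: "a \<le> b"
    and x: "\<And>t. t \<in> {a..b} \<Longrightarrow> (v has_integral (x t - x a)) {a..t}"
    and deriv: "\<And>t. t \<in> {a..b} \<Longrightarrow> (h has_derivative h' t) (at (x t))"
    and bound: "\<And>t u. t \<in> {a..b} \<Longrightarrow> norm (h' t u) \<le> L * norm u"
    and L: "L \<ge> 0"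
  shows "((\<lambda>t. h' t (v t)) has_integral (h (x b) - h (x a))) {a..b}"
  unfolding has_integral_real
proof (intro allI impI)
  fix e :: real assume e: "e > 0"
  define k where "k = e / (2 * (b - a + 1))"
  have k: "k > 0" using e ab by (simp add: k_def)
  define e1 where "e1 = e / 4 / (L + k)"
  have e1: "e1 > 0" using e k L by (simp add: e1_def)
  have int: "v integrable_on cbox a b" using x[of b] ab by auto
  note incr = indefinite_integral_increment[OF x]
  have cont: "continuous_on {a..b} x" by (rule indefinite_integral_continuous[OF ab x])
  have "\<exists>r>0. t \<in> {a..b} \<longrightarrow> (\<forall>s. s \<in> {a..b} \<longrightarrow> \<bar>s - t\<bar> < r \<longrightarrow>
    norm (h (x s) - h (x t) - (s - t) *\<^sub>R h' t (v t))
      \<le> k * \<bar>s - t\<bar> + (L + k) * norm (x s - x t - (s - t) *\<^sub>R v t))" for t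
  proof (cases "t \<in> {a..b}")
    case True
    show ?thesis
      by (rule first_order_expansion_near[OF cont True deriv[OF True] bound[OF True] k, of v]) blast
  qed (auto intro: exI[of _ 1])
  then obtain r where r: "\<And>t. r t > 0" "\<And>t s. \<lbrakk>t \<in> {a..b}; s \<in> {a..b}; \<bar>s - t\<bar> < r t\<rbrakk> \<Longrightarrow>
    norm (h (x s) - h (x t) - (s - t) *\<^sub>R h' t (v t))
      \<le> k * \<bar>s - t\<bar> + (L + k) * norm (x s - x t - (s - t) *\<^sub>R v t)"
    by metis
  obtain \<gamma> where \<gamma>: "gauge \<gamma>" and henstock:
    "\<And>q. \<lbrakk>q tagged_partial_division_of cbox a b; \<gamma> fine q\<rbrakk> \<Longrightarrow>
      (\<Sum>(t,K)\<in>q. norm (content K *\<^sub>R v t - integral K v)) < e1"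
    using Henstock_lemma[OF int e1] by blast
  show "\<exists>\<gamma>. gauge \<gamma> \<and> (\<forall>\<D>. \<D> tagged_division_of {a..b} \<and> \<gamma> fine \<D> \<longrightarrow>
      norm ((\<Sum>(t,K)\<in>\<D>. content K *\<^sub>R h' t (v t)) - (h (x b) - h (x a))) < e)"
  proof (intro exI conjI allI impI)
    show "gauge (\<lambda>t. \<gamma> t \<inter> ball t (r t))"
      using \<gamma> r(1) by (simp add: gauge_Int gauge_ball_dependent)
    fix D assume D: "D tagged_division_of {a..b} \<and> (\<lambda>t. \<gamma> t \<inter> ball t (r t)) fine D"
    then have tag: "D tagged_division_of cbox a b" and fine: "\<gamma> fine D" "(\<lambda>t. ball t (r t)) fine D"
      by (auto simp: fine_Int)
    have part: "D tagged_partial_division_of cbox a b"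
      using tag by (simp add: tagged_division_of_def)
    \<comment> \<open>The expansion is centred at the tag, which is in general interior to its cell; hence the two
      halves.\<close>
    let ?J1 = "\<lambda>t K. {Inf K..t}" and ?J2 = "\<lambda>t K. {t..Sup K}"
    let ?err = "\<lambda>t K. norm (content K *\<^sub>R v t - integral K v)"
    have cell: "a \<le> Inf K \<and> Inf K \<le> t \<and> t \<le> Sup K \<and> Sup K \<le> b \<and> K = {Inf K..Sup K} \<and>
        \<bar>Inf K - t\<bar> < r t \<and> \<bar>Sup K - t\<bar> < r t" if tK: "(t,K) \<in> D" for t K
    proof -
      obtain u w where K: "K = {u..w}" using tagged_division_ofD(4)[OF tag tK] by auto
      have uw: "u \<le> t" "t \<le> w" using tagged_division_ofD(2)[OF tag tK] K by auto
      then have IS: "Inf K = u" "Sup K = w" using K by auto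
      have "K \<subseteq> {a..b}" "K \<subseteq> ball t (r t)"
        using tagged_division_ofD(3)[OF tag tK] fine(2) tK by (auto simp: fine_def)
      moreover have "u \<in> K" "w \<in> K" using K uw by auto
      ultimately have "{u, w} \<subseteq> {a..b} \<inter> ball t (r t)" by blast
      then show ?thesis using uw K IS by (simp add: dist_real_def abs_minus_commute)
    qed
    have cell_bound: "norm (content K *\<^sub>R h' t (v t) - (h (x (Sup K)) - h (x (Inf K))))
        \<le> k * content K + (L + k) * (?err t (?J1 t K) + ?err t (?J2 t K))"
      if tK: "(t,K) \<in> D" for t K
    proof -
      define u w where "u = Inf K" and "w = Sup K"
      have c: "a \<le> u" "u \<le> t" "t \<le> w" "w \<le> b" "K = {u..w}" "\<bar>u - t\<bar> < r t" "\<bar>w - t\<bar> < r t"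
        using cell[OF tK] by (auto simp: u_def w_def)
      have t: "t \<in> {a..b}" "u \<in> {a..b}" "w \<in> {a..b}" using c by auto
      have E1: "?err t {u..t} = norm (x u - x t - (u - t) *\<^sub>R v t)"
      proof -
        have "integral {u..t} v = x t - x u" using c by (intro integral_unique incr) auto
        then have "?err t {u..t} = norm ((t - u) *\<^sub>R v t - (x t - x u))"
          using c(2) by (simp only: content_real)
        also have "(t - u) *\<^sub>R v t - (x t - x u) = x u - x t - (u - t) *\<^sub>R v t"
          by (simp add: algebra_simps)
        finally show ?thesis .
      qed
      have E2: "?err t {t..w} = norm (x w - x t - (w - t) *\<^sub>R v t)"
      proof -
        have "integral {t..w} v = x w - x t" using c by (intro integral_unique incr) auto
        then show ?thesis using c norm_minus_commute by simp
      qed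
      have "content K *\<^sub>R h' t (v t) - (h (x w) - h (x u)) =
        (h (x u) - h (x t) - (u - t) *\<^sub>R h' t (v t)) - (h (x w) - h (x t) - (w - t) *\<^sub>R h' t (v t))"
        using c by (simp add: algebra_simps)
      also have "norm \<dots> \<le> (k * \<bar>u - t\<bar> + (L + k) * ?err t {u..t}) + (k * \<bar>w - t\<bar> + (L + k) * ?err t {t..w})"
        unfolding E1 E2
        by (intro order.trans[OF norm_triangle_ineq4] add_mono r(2) t c)
      also have "\<dots> = k * content K + (L + k) * (?err t {u..t} + ?err t {t..w})"
        using c by (simp add: algebra_simps)
      finally show ?thesis by (simp add: u_def w_def)
    qed
    have halves: "(\<exists>u w. {Inf K..t} = cbox u w) \<and> t \<in> {Inf K..t} \<and> {Inf K..t} \<subseteq> K"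
      "(\<exists>u w. {t..Sup K} = cbox u w) \<and> t \<in> {t..Sup K} \<and> {t..Sup K} \<subseteq> K"
      if "(t,K) \<in> D" for t K
    proof -
      have c: "Inf K \<le> t" "t \<le> Sup K" "K = {Inf K..Sup K}" using cell[OF that] by blast+
      have "{Inf K..t} \<subseteq> {Inf K..Sup K}" "{t..Sup K} \<subseteq> {Inf K..Sup K}" using c(1,2) by auto
      then have "{Inf K..t} \<subseteq> K" "{t..Sup K} \<subseteq> K" using c(3) by blast+
      then show "(\<exists>u w. {Inf K..t} = cbox u w) \<and> t \<in> {Inf K..t} \<and> {Inf K..t} \<subseteq> K"
        "(\<exists>u w. {t..Sup K} = cbox u w) \<and> t \<in> {t..Sup K} \<and> {t..Sup K} \<subseteq> K"
        using c(1,2) by (metis atLeastAtMost_iff box_real(2) order_refl)+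
    qed
    have half1: "(\<Sum>(t,K)\<in>D. ?err t (?J1 t K)) < e1"
      by (rule Henstock_bound_subcells[OF _ part fine(1), where J = ?J1])
        (erule (1) henstock, rule halves(1))
    have half2: "(\<Sum>(t,K)\<in>D. ?err t (?J2 t K)) < e1"
      by (rule Henstock_bound_subcells[OF _ part fine(1), where J = ?J2])
        (erule (1) henstock, rule halves(2))
    have telescope: "(\<Sum>(t,K)\<in>D. content K *\<^sub>R h' t (v t)) - (h (x b) - h (x a)) =
        (\<Sum>(t,K)\<in>D. content K *\<^sub>R h' t (v t) - (h (x (Sup K)) - h (x (Inf K))))"
      using additive_tagged_division_1[OF ab, of D "\<lambda>s. h (x s)"] D
      by (simp add: sum_subtractf case_prod_unfold)
    have "norm ((\<Sum>(t,K)\<in>D. content K *\<^sub>R h' t (v t)) - (h (x b) - h (x a)))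
        \<le> (\<Sum>(t,K)\<in>D. k * content K + (L + k) * (?err t (?J1 t K) + ?err t (?J2 t K)))"
      unfolding telescope
      by (rule sum_norm_le) (clarsimp simp only: split_paired_all split_conv cell_bound)
    also have "\<dots> = k * (\<Sum>(t,K)\<in>D. content K) +
        (L + k) * ((\<Sum>(t,K)\<in>D. ?err t (?J1 t K)) + (\<Sum>(t,K)\<in>D. ?err t (?J2 t K)))"
      by (simp only: case_prod_unfold sum.distrib sum_distrib_left[symmetric])
    also have "\<dots> < k * (b - a + 1) + (L + k) * (e1 + e1)"
      using additive_content_tagged_division[OF tag] ab k L half1 half2
      by (intro add_strict_mono mult_strict_left_mono) auto
    also have "\<dots> = e"
    proof -
      have "k * (b - a + 1) = e / 2" using ab by (simp add: k_def field_simps)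
      moreover have "(L + k) * e1 = e / 4"
        using nonzero_eq_divide_eq[of "L + k" e1 "e / 4"] e1_def L k by (simp only: mult.commute) simp
      ultimately show ?thesis by (simp add: distrib_left)
    qed
    finally show "norm ((\<Sum>(t,K)\<in>D. content K *\<^sub>R h' t (v t)) - (h (x b) - h (x a))) < e" .
  qed
qed

section \<open>Comparison with exponential decay\<close>

lemma first_zero:
  fixes w :: "real \<Rightarrow> real"
  assumes cont: "continuous_on {a..b} w" and ab: "a \<le> b" and pos: "w a > 0" and nonpos: "w b \<le> 0"
  obtains T where "a < T" "T \<le> b" "w T = 0" "\<And>s. \<lbrakk>a \<le> s; s < T\<rbrakk> \<Longrightarrow> w s > 0"
proof -
  define Z where "Z = {t \<in> {a..b}. w t \<le> 0}"
  have "closed Z" unfolding Z_def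
    by (intro continuous_on_closed_Collect_le cont continuous_intros closed_atLeastAtMost)
  then have "compact Z"
    by (metis Z_def bounded_closed_interval bounded_subset compact_eq_bounded_closed mem_Collect_eq subsetI)
  moreover have "b \<in> Z" using ab nonpos by (simp add: Z_def)
  ultimately obtain T where T: "T \<in> Z" "\<And>s. s \<in> Z \<Longrightarrow> T \<le> s"
    using compact_attains_inf[of Z] by blast
  have TD: "a \<le> T" "T \<le> b" "w T \<le> 0" using T(1) by (auto simp: Z_def)
  have before: "w s > 0" if "a \<le> s" "s < T" for s
    using T(2)[of s] that TD by (force simp: Z_def)
  have "\<exists>z. a \<le> z \<and> z \<le> T \<and> w z = 0"
    using TD pos continuous_on_subset[OF cont] by (intro IVT2') auto
  then have "w T = 0" using before by (metis less_le less_irrefl)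
  moreover have "a < T" using TD pos by (metis less_le not_less)
  ultimately show thesis using that TD before by blast
qed

text \<open>
  The integrated form of \<open>w' \<ge> - c w\<close> and \<open>w a > 0\<close>. At a first zero \<open>T\<close>, look at the maximum \<open>w m > 0\<close> of
  \<open>w\<close> over an interval \<open>[s, T]\<close> so short that \<open>c (T - s) \<le> 1/2\<close>: to get from \<open>w m\<close> down to \<open>0\<close> at a rate
  of at most \<open>c (w m)\<close>, \<open>w\<close> needs a time \<open>\<tau>\<close> with \<open>c \<tau> \<ge> 1\<close>.
\<close>
lemma positive_if_rate_ge:
  fixes w \<rho> :: "real \<Rightarrow> real"
  assumes c: "c \<ge> 0" and w: "\<And>t. t \<in> {a..b} \<Longrightarrow> (\<rho> has_integral (w t - w a)) {a..t}"
    and rate: "\<And>t. t \<in> {a..b} \<Longrightarrow> \<rho> t \<ge> - c * w t"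
    and pos: "w a > 0" and t: "t \<in> {a..b}"
  shows "w t > 0"
proof (rule ccontr)
  assume "\<not> w t > 0"
  have cont: "continuous_on {a..b} w"
    using t w by (intro indefinite_integral_continuous[of a b \<rho> w]) auto
  obtain T where T: "a < T" "T \<le> t" "w T = 0" and before: "\<And>s. \<lbrakk>a \<le> s; s < T\<rbrakk> \<Longrightarrow> w s > 0"
    using first_zero[of a t w] t \<open>\<not> w t > 0\<close> pos continuous_on_subset[OF cont, of "{a..t}"] by auto
  \<comment> \<open>The denominator has \<open>c + 1\<close> instead of \<open>c\<close> because \<open>c\<close> may be \<open>0\<close>.\<close>
  define s where "s = max a (T - 1 / (2 * (c + 1)))"
  have s: "a \<le> s" "s < T" "c * (T - s) \<le> 1/2"
  proof -
    show "a \<le> s" "s < T" using T c by (auto simp: s_def)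
    have "c * (T - s) \<le> c * (1 / (2 * (c + 1)))" using c by (intro mult_left_mono) (auto simp: s_def)
    also have "\<dots> \<le> 1/2" using c by (simp add: field_simps)
    finally show "c * (T - s) \<le> 1/2" .
  qed
  obtain m where m: "m \<in> {s..T}" "\<And>y. y \<in> {s..T} \<Longrightarrow> w y \<le> w m"
    using continuous_attains_sup[of "{s..T}" w] continuous_on_subset[OF cont, of "{s..T}"] s T t
    by auto
  have wm: "w m > 0" using m(2)[of s] before[of s] s by auto
  have "((\<lambda>_. - c * w m) has_integral (T - m) * (- c * w m)) {m..T}"
    using has_integral_const_real[of "- c * w m" m T] m by simp
  moreover have "(\<rho> has_integral (w T - w m)) {m..T}"
    using m s T t by (intro indefinite_integral_increment[OF w]) auto
  ultimately have "(T - m) * (- c * w m) \<le> w T - w m"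
  proof (rule has_integral_le)
    fix y assume y: "y \<in> {m..T}"
    have "- c * w m \<le> - c * w y" using m(2)[of y] y m c by (auto intro: mult_left_mono)
    also have "\<dots> \<le> \<rho> y" using rate[of y] y m s T t by auto
    finally show "- c * w m \<le> \<rho> y" .
  qed
  then have "w m \<le> (c * (T - m)) * w m" using T by (simp add: algebra_simps)
  also have "\<dots> \<le> (c * (T - s)) * w m" using c m wm by (intro mult_right_mono mult_left_mono) auto
  also have "\<dots> \<le> 1/2 * w m" using s wm by (intro mult_right_mono) auto
  finally show False using wm by simp
qed

section \<open>Barrier functions along the closed loop\<close>

lemma has_derivative_row_deriv:
  assumes "h differentiable (at y)"
  shows "(h has_derivative (\<lambda>u. row_deriv h y \<bullet> u)) (at y)"
proof -
  let ?D = "frechet_derivative h (at y)"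
  have D: "(h has_derivative ?D) (at y)" using assms frechet_derivative_works by blast
  then have lin: "linear ?D" by (rule has_derivative_linear)
  have "?D u = row_deriv h y \<bullet> u" for u
  proof -
    have "?D u = ?D (\<Sum>i\<in>UNIV. u $ i *\<^sub>R axis i 1)"
      using basis_expansion[of u] by (simp add: scalar_mult_eq_scaleR)
    also have "\<dots> = (\<Sum>i\<in>UNIV. u $ i * ?D (axis i 1))"
      using lin by (simp add: linear_sum linear_scale)
    also have "\<dots> = row_deriv h y \<bullet> u" by (simp add: row_deriv_def inner_vec_def mult.commute)
    finally show ?thesis .
  qed
  then have "?D = (\<lambda>u. row_deriv h y \<bullet> u)" by auto
  then show ?thesis using D by simp
qed

text \<open>
  Continuous differentiability of \<open>h\<close> provides the bound on the gradient along the compact arc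
  \<open>x ` {a..b}\<close> that the chain rule asks for.
\<close>
lemma positive_along_trajectory:
  fixes x v :: "real \<Rightarrow> real ^ 'N" and h :: "real ^ 'N \<Rightarrow> real"
  assumes h: "continuously_differentiable h"
    and x: "\<And>t. t \<in> {a..b} \<Longrightarrow> (v has_integral (x t - x a)) {a..t}"
    and c: "c \<ge> 0"
    and rate: "\<And>t. t \<in> {a..b} \<Longrightarrow> row_deriv h (x t) \<bullet> v t \<ge> - c * h (x t)"
    and pos: "h (x a) > 0" and t: "t \<in> {a..b}"
  shows "h (x t) > 0"
proof -
  have "a \<le> b" using t by auto
  then have contx: "continuous_on {a..b} x" using x by (rule indefinite_integral_continuous)
  have "continuous_on UNIV (row_deriv h)" using h by (simp add: continuously_differentiable_def)
  then have "continuous_on {a..b} (\<lambda>t. row_deriv h (x t))"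
    using continuous_on_compose2[OF _ contx] by blast
  then have "bounded ((\<lambda>t. row_deriv h (x t)) ` {a..b})"
    using compact_continuous_image compact_imp_bounded compact_Icc by blast
  then obtain L where L: "L > 0" "\<And>t. t \<in> {a..b} \<Longrightarrow> norm (row_deriv h (x t)) \<le> L"
    unfolding bounded_pos by auto
  show ?thesis
  proof (rule positive_if_rate_ge[where w = "\<lambda>s. h (x s)", OF c _ rate pos t])
    fix s assume s: "s \<in> {a..b}"
    show "((\<lambda>t. row_deriv h (x t) \<bullet> v t) has_integral (h (x s) - h (x a))) {a..s}"
    proof (rule has_integral_chain_rule[where L = L and x = x and v = v and h = h])
      fix t assume t: "t \<in> {a..s}"
      then have tb: "t \<in> {a..b}" using s by auto
      show "(v has_integral (x t - x a)) {a..t}" using x[OF tb] .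
      show "(h has_derivative (\<bullet>) (row_deriv h (x t))) (at (x t))"
        using h has_derivative_row_deriv by (auto simp: continuously_differentiable_def)
      fix u
      have "norm (row_deriv h (x t) \<bullet> u) \<le> norm (row_deriv h (x t)) * norm u"
        by (simp add: Cauchy_Schwarz_ineq2)
      also have "\<dots> \<le> L * norm u" using L(2)[OF tb] by (intro mult_right_mono) auto
      finally show "norm (row_deriv h (x t) \<bullet> u) \<le> L * norm u" .
    qed (use s L in auto)
  qed
qed

lemma row_deriv_inner_closed_loop:
  "row_deriv h y \<bullet> (f y + g y *v u + p y *v d) =
    lie_deriv f h y + lie_deriv_row g h y \<bullet> u + lie_deriv_row p h y \<bullet> d"
  by (simp add: lie_deriv_def lie_deriv_row_def inner_add_right dot_lmul_matrix)

text \<open>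
  By Cauchy-Schwarz, and because \<open>sqrt (e + r\<^sup>2) \<ge> r\<close>: smoothing the norm errs on the safe side.
\<close>
lemma disturbance_term_ge:
  assumes "norm d \<le> M" "e \<ge> 0"
  shows "lie_deriv_row p h y \<bullet> d \<ge> - M * barrier_delta p e h y"
proof -
  let ?r = "lie_deriv_row p h y"
  have "norm ?r \<le> barrier_delta p e h y"
    unfolding barrier_delta_def using assms by (intro real_le_rsqrt) simp
  then have "norm ?r * norm d \<le> barrier_delta p e h y * M"
    using assms by (intro mult_mono) (auto intro: order.trans[OF norm_ge_zero])
  then show ?thesis
    using Cauchy_Schwarz_ineq2[of ?r d] by (simp add: mult.commute abs_le_iff)
qed

text \<open>
  \<^const>\<open>barrier_eta\<close> is affine in the control, and nonnegativity of it is the constraint of the quadratic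
  program. The control moves the nominal value along \<^term>\<open>lie_deriv_row g h y\<close> just far enough to make it \<open>0\<close> when it
  would be negative.
\<close>
lemma barrier_eta_control_nonneg:
  assumes "lie_deriv_row g h y \<noteq> 0"
  shows "barrier_eta f g p M e c h y (barrier_control f g p M e c h y v) \<ge> 0"
proof (cases "barrier_eta f g p M e c h y v \<ge> 0")
  case True
  then show ?thesis by (simp add: barrier_control_def)
next
  case False
  let ?r = "lie_deriv_row g h y" and ?\<eta> = "barrier_eta f g p M e c h y v"
  have "barrier_eta f g p M e c h y (barrier_control f g p M e c h y v) =
      ?\<eta> - ?\<eta> / (norm ?r)\<^sup>2 * (?r \<bullet> ?r)"
    using False by (simp add: barrier_control_def) (simp add: barrier_eta_def inner_diff_right)
  also have "\<dots> = 0" using assms by (simp add: power2_norm_eq_inner)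
  finally show ?thesis by simp
qed

theorem theorem1:
  fixes f :: "real ^ 'N \<Rightarrow> real ^ 'N"
    and g :: "real ^ 'N \<Rightarrow> real ^ 'm1 ^ 'N"
    and p :: "real ^ 'N \<Rightarrow> real ^ 'm2 ^ 'N"
    and h :: "nat \<Rightarrow> real ^ 'N \<Rightarrow> real"
    and \<epsilon> c :: "nat \<Rightarrow> real"
    and M t0 :: real
    and n :: nat
    and x0 :: "real ^ 'N"
    and u0 :: "real \<Rightarrow> real ^ 'm1"
    and d :: "real \<Rightarrow> real ^ 'm2"
    and x :: "real \<Rightarrow> real ^ 'N"
  assumes M_pos: "M > 0"
    and n_gt_1: "n > 1"
    and candidate: "candidate_barrier (h 1)"
    and n_times_diff: "times_differentiable n (h 1)"
    and deriv_nonzero: "\<forall>y\<in>safe_set (h 1). row_deriv (h 1) y \<noteq> 0"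
    and eps_pos: "\<forall>k\<in>{1..n}. \<epsilon> k > 0"
    and chain: "\<forall>i\<in>{2..n}. \<forall>y. h i y =
        c (i - 1) * h (i - 1) y + lie_deriv f (h (i - 1)) y
          - M * barrier_delta p (\<epsilon> (i - 1)) (h (i - 1)) y"
    and chain_C1: "\<forall>k\<in>{1..n}. continuously_differentiable (h k)"
    and rel_degree: "has_relative_degree g h n"
    and init_safe: "h 1 x0 > 0"
    and gains: "\<forall>i\<in>{2..n}. c (i - 1) >
        max 0 ((- lie_deriv f (h (i - 1)) x0 + M * barrier_delta p (\<epsilon> (i - 1)) (h (i - 1)) x0)
                 / h (i - 1) x0)"
    and last_gain: "c n > 0"
    and disturbance: "\<forall>t\<ge>t0. norm (d t) \<le> M"
    and solution: "ode_solution
        (\<lambda>t y. f y + g y *v barrier_control f g p M (\<epsilon> n) (c n) (h n) y (u0 t) + p y *v d t) t0 x"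
    and init: "x t0 = x0"
  shows "\<forall>t\<ge>t0. h 1 (x t) \<ge> 0"
proof (rule ccontr)
  define u where "u t = barrier_control f g p M (\<epsilon> n) (c n) (h n) (x t) (u0 t)" for t
  define v where "v t = f (x t) + g (x t) *v u t + p (x t) *v d t" for t
  have x: "(v has_integral (x t - x t0)) {t0..t}" if "t \<ge> t0" for t
    using solution that unfolding ode_solution_def v_def u_def by blast
  have chain': "h (Suc k) y = c k * h k y + lie_deriv f (h k) y - M * barrier_delta p (\<epsilon> k) (h k) y"
    if "1 \<le> k" "k < n" for k y
    using chain[rule_format, of "Suc k"] that by simp
  have gain_pos: "c k > 0" if "1 \<le> k" "k < n" for k
    using gains[rule_format, of "Suc k"] that by simp
  have init_pos: "h k x0 > 0" if "1 \<le> k" "k \<le> n" for k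
    using that
  proof (induction k rule: nat_induct_at_least)
    case base
    show ?case using init_safe .
  next
    case (Suc k)
    then have "h k x0 > 0" by simp
    then show ?case
      using gains[rule_format, of "Suc k"] chain'[of k x0] Suc by (simp add: field_simps)
  qed
  have rate: "row_deriv (h k) (x t) \<bullet> v t \<ge>
      lie_deriv f (h k) (x t) + lie_deriv_row g (h k) (x t) \<bullet> u t - M * barrier_delta p (\<epsilon> k) (h k) (x t)"
    if "k \<in> {1..n}" "t \<ge> t0" for k t
  proof -
    have "norm (d t) \<le> M" "\<epsilon> k \<ge> 0" using disturbance eps_pos that by (auto intro: less_imp_le)
    from disturbance_term_ge[OF this, of p "h k" "x t"] show ?thesis
      by (simp add: v_def row_deriv_inner_closed_loop)
  qed
  \<comment> \<open>The control law enforces its constraint only on the safe set, so the argument is confined to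
    the time before the first exit.\<close>
  assume "\<not> (\<forall>t\<ge>t0. h 1 (x t) \<ge> 0)"
  then obtain t1 where t1: "t1 \<ge> t0" "h 1 (x t1) < 0" by auto
  have "continuous_on {t0..t1} x" using t1 x by (intro indefinite_integral_continuous) auto
  moreover have "continuous_on UNIV (h 1)"
    using chain_C1 n_gt_1
    by (auto simp: continuously_differentiable_def continuous_on_eq_continuous_at differentiable_imp_continuous_within)
  ultimately have "continuous_on {t0..t1} (\<lambda>t. h 1 (x t))"
    using continuous_on_compose2 by blast
  then obtain T where T: "t0 < T" "h 1 (x T) = 0" and before: "\<And>s. \<lbrakk>t0 \<le> s; s < T\<rbrakk> \<Longrightarrow> h 1 (x s) > 0"
    using first_zero[of t0 t1 "\<lambda>t. h 1 (x t)"] t1 init_safe init by auto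
  have safe: "x t \<in> safe_set (h 1)" if "t \<in> {t0..T}" for t
    using that T before[of t] by (cases "t = T") (auto simp: safe_set_def)
  have "\<forall>t\<in>{t0..T}. h k (x t) > 0" if "1 \<le> k" "k \<le> n" for k
    using that(2,1)
  proof (induction k rule: inc_induct)
    case base
    show ?case
    proof
      fix t assume t: "t \<in> {t0..T}"
      show "h n (x t) > 0"
      proof (rule positive_along_trajectory[where c = "c n", OF _ _ _ _ _ t])
        fix s assume s: "s \<in> {t0..T}"
        have "lie_deriv_row g (h n) (x s) \<noteq> 0"
          using rel_degree safe[OF s] by (auto simp: has_relative_degree_def)
        then have "barrier_eta f g p M (\<epsilon> n) (c n) (h n) (x s) (u s) \<ge> 0"
          unfolding u_def by (rule barrier_eta_control_nonneg)
        then show "row_deriv (h n) (x s) \<bullet> v s \<ge> - c n * h n (x s)"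
          using rate[of n s] s n_gt_1 by (simp add: barrier_eta_def)
      qed (use chain_C1 n_gt_1 x last_gain init init_pos in auto)
    qed
  next
    case (step k)
    then have next_pos: "\<forall>t\<in>{t0..T}. h (Suc k) (x t) > 0" by simp
    show ?case
    proof
      fix t assume t: "t \<in> {t0..T}"
      show "h k (x t) > 0"
      proof (rule positive_along_trajectory[where c = "c k", OF _ _ _ _ _ t])
        fix s assume s: "s \<in> {t0..T}"
        have "lie_deriv_row g (h k) (x s) = 0"
          using rel_degree step by (auto simp: has_relative_degree_def)
        then show "row_deriv (h k) (x s) \<bullet> v s \<ge> - c k * h k (x s)"
          using rate[of k s] s step next_pos chain'[of k "x s"] by force
      qed (use chain_C1 x gain_pos[of k] init init_pos[of k] step in auto)
    qed
  qed
  then have "\<forall>t\<in>{t0..T}. h 1 (x t) > 0" using n_gt_1 by (metis order_refl less_imp_le)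
  from bspec[OF this, of T] show False using T by simp
qed

end
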